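(* Let $F$ be a simple graph of order $n\ge2$, let $E_k=\{e_1,\ldots,e_k\}\subseteq E(F)$ with $|E_k|=k$, and suppose the subgraph $\mathscr E_k$ of $F$ induced by $E_k$ is $r$-regular; let $p=2k/r$ be its number of vertices. Let $H_{uv}$ be a simple graph of order $m\ge3$ with a specified edge $uv$ such that $u$ and $v$ both have degree $m-1$ in $H_{uv}$. Put $H_2=H_{uv}-\{u,v\}$ and $G=G[F,E_k,H_{uv}]$. Order the vertices of $F$ so that the vertices of $\mathscr E_k$ come first. Then the characteristic polynomial of the signless Laplacian matrix of $G$ is $$f_{Q(G)}(x)=\bigl(f_{Q(H_2)}(x-2)\bigr)^k\det(xI_n-M),$$ $$M=Q(F)+r(m-2)\begin{pmatrix} I_p&0\\0&0\end{pmatrix}+\Gamma_{Q(H_2)}(x-2)\begin{pmatrix}Q(\mathscr E_k)&0\\0&0\end{pmatrix},$$ where the block matrices are $n\times n$.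
   Context: All graphs are finite and simple. $Q(X)=D(X)+A(X)$ is the signless Laplacian matrix of a graph $X$ ($D$ the diagonal degree matrix, $A$ the adjacency matrix). For a square matrix $N$ of order $s$, $f_N(x)=\det(xI_s-N)$ is its characteristic polynomial, and its coronal is $\Gamma_N(x)=\mathbf 1_s^T(xI_s-N)^{-1}\mathbf 1_s$, a rational function of $x$, where $\mathbf 1_s$ is the all-ones column vector; the identity is an identity of rational functions in $x$. The subgraph induced by an edge set $E_k$ has edge set $E_k$ and vertex set the endpoints of edges in $E_k$. Graph with $k$ edge-pockets: $H_{uv}$ is a graph with a specified edge $uv$ such that $H_{uv}-u\cong H_{uv}-v$ (automatic when $u,v$ both have degree $m-1$). $G[F,E_k,H_{uv}]$ is obtained by taking one copy of $F$ and $k$ vertex-disjoint copies of $H_{uv}$, and, for each $i=1,\ldots,k$, pasting (identifying) the edge $uv$ of the $i$th copy of $H_{uv}$ with the edge $e_i$ of $F$. *)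

theory Defs
  imports
    "Jordan_Normal_Form.Char_Poly"
    "Jordan_Normal_Form.Gauss_Jordan_Elimination"
    "HOL-Computational_Algebra.Polynomial_Factorial"
begin

section \<open>Finite simple graphs\<close>

record 'a sgraph =
  verts :: "'a set"
  edges :: "'a set set"

definition simple_graph :: "'a sgraph \<Rightarrow> bool" where
  "simple_graph G \<longleftrightarrow> finite (verts G) \<and> (\<forall>e\<in>edges G. e \<subseteq> verts G \<and> card e = 2)"

definition vertex_degree :: "'a sgraph \<Rightarrow> 'a \<Rightarrow> nat" where
  "vertex_degree G x = card {e \<in> edges G. x \<in> e}"

definition regular_graph :: "'a sgraph \<Rightarrow> nat \<Rightarrow> bool" where
  "regular_graph G r \<longleftrightarrow> (\<forall>x\<in>verts G. vertex_degree G x = r)"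

definition edge_induced :: "'a set set \<Rightarrow> 'a sgraph" where
  "edge_induced E = \<lparr>verts = \<Union>E, edges = E\<rparr>"

definition delete_verts :: "'a sgraph \<Rightarrow> 'a set \<Rightarrow> 'a sgraph" where
  "delete_verts G S = \<lparr>verts = verts G - S, edges = {e \<in> edges G. e \<inter> S = {}}\<rparr>"

section \<open>Graphs with edge-pockets\<close>

text \<open>
  The graph obtained from \<open>F\<close> by pasting one copy of \<open>H\<close> along its edge \<open>uv\<close> onto every
  edge \<open>e \<in> E\<close>; the copies are indexed by the edges in \<open>E\<close>. In the copy belonging to
  \<open>e = {s e, t e}\<close>, the vertex \<open>u\<close> is identified with \<open>s e\<close> and \<open>v\<close> with \<open>t e\<close>.
  Every identification class contains either exactly one vertex of \<open>F\<close>, and is then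
  represented by \<open>Inl\<close> of it, or just one vertex \<open>w \<noteq> u, v\<close> of one copy, and is then
  represented by \<open>Inr (e, w)\<close>. The function \<open>pocket_map\<close> sends a vertex of the copy
  at \<open>e\<close> to its class.

  The requirement \<open>H - u \<cong> H - v\<close> is not part of the definition; it holds automatically when
  \<open>u\<close> and \<open>v\<close> are both adjacent to all other vertices of \<open>H\<close>.
\<close>

definition pocket_map ::
    "'b \<Rightarrow> 'b \<Rightarrow> ('a set \<Rightarrow> 'a) \<Rightarrow> ('a set \<Rightarrow> 'a) \<Rightarrow> 'a set \<Rightarrow> 'b \<Rightarrow> 'a + 'a set \<times> 'b" where
  "pocket_map u v s t e w =
     (if w = u then Inl (s e) else if w = v then Inl (t e) else Inr (e, w))"

definition edge_pocket_graph ::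
    "'a sgraph \<Rightarrow> 'a set set \<Rightarrow> 'b sgraph \<Rightarrow> 'b \<Rightarrow> 'b \<Rightarrow> ('a set \<Rightarrow> 'a) \<Rightarrow> ('a set \<Rightarrow> 'a)
      \<Rightarrow> ('a + 'a set \<times> 'b) sgraph" where
  "edge_pocket_graph F E H u v s t =
     \<lparr>verts = Inl ` verts F \<union> (\<Union>e\<in>E. pocket_map u v s t e ` verts H),
      edges = (`) Inl ` edges F \<union> (\<Union>e\<in>E. (`) (pocket_map u v s t e) ` edges H)\<rparr>"

section \<open>Signless Laplacian matrix\<close>

text \<open>Matrices of a graph are taken with respect to an ordering \<open>xs\<close> of its vertices.\<close>

definition vertex_ordering :: "'a list \<Rightarrow> 'a sgraph \<Rightarrow> bool" where
  "vertex_ordering xs G \<longleftrightarrow> distinct xs \<and> set xs = verts G"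

definition adjacency_mat :: "'a list \<Rightarrow> 'a sgraph \<Rightarrow> real mat" where
  "adjacency_mat xs G = mat (length xs) (length xs)
     (\<lambda>(i, j). if {xs ! i, xs ! j} \<in> edges G then 1 else 0)"

definition degree_mat :: "'a list \<Rightarrow> 'a sgraph \<Rightarrow> real mat" where
  "degree_mat xs G = mat (length xs) (length xs)
     (\<lambda>(i, j). if i = j then real (vertex_degree G (xs ! i)) else 0)"

definition signless_laplacian :: "'a list \<Rightarrow> 'a sgraph \<Rightarrow> real mat" where
  "signless_laplacian xs G = degree_mat xs G + adjacency_mat xs G"

section \<open>Rational functions and the coronal\<close>

type_synonym ratfun = "real poly fract"

definition rf_const :: "real \<Rightarrow> ratfun" where
  "rf_const c = to_fract [:c:]"

definition rf_X :: ratfun where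
  "rf_X = to_fract [:0, 1:]"

text \<open>
  \<open>coronal N y\<close> is the coronal of \<open>N\<close> with the rational function \<open>y\<close> put in place of the
  indeterminate, so the coronal itself is \<open>coronal N rf_X\<close>. The matrix \<open>y I - N\<close> is
  invertible over the field of rational functions for every non-constant \<open>y\<close>;
  for other \<open>y\<close> the value may be unspecified.
\<close>

definition coronal :: "real mat \<Rightarrow> ratfun \<Rightarrow> ratfun" where
  "coronal N y =
    (let d = dim_row N; one = vec d (\<lambda>_. 1)
     in one \<bullet> (the (mat_inverse (y \<cdot>\<^sub>m 1\<^sub>m d - map_mat rf_const N)) *\<^sub>v one))"

text \<open>The \<open>n \<times> n\<close> matrix with top left block \<open>A\<close> and all other blocks zero.\<close>

definition corner_block :: "nat \<Rightarrow> ratfun mat \<Rightarrow> ratfun mat" where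
  "corner_block n A =
    (let d = dim_row A
     in four_block_mat A (0\<^sub>m d (n - d)) (0\<^sub>m (n - d) d) (0\<^sub>m (n - d) (n - d)))"

end

theory Submission
  imports Defs "Subresultants.More_Homomorphisms"
begin

text \<open>
  List the vertices of \<open>G\<close> so that those of \<open>F\<close> come first, followed by one block of copies of
  \<open>H\<^sub>2\<close> for each pocket. In \<open>x I - Q(G)\<close> the block of a pocket at the edge \<open>e\<close> is
  \<open>D = (x - 2) I - Q(H\<^sub>2)\<close>; it does not interact with the other pockets, and it is joined to the
  vertices of \<open>F\<close> through the rank one matrix \<open>- b 1\<^sup>T\<close>, where \<open>b\<close> is the indicator of the
  two ends of \<open>e\<close>. Taking a Schur complement therefore splits off the factor \<open>det D\<close> and subtracts
  \<open>(1\<^sup>T D\<^sup>-\<^sup>1 1) b b\<^sup>T\<close>, a coronal times \<open>b b\<^sup>T\<close>, from the block of \<open>F\<close>. Once all pockets have been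
  eliminated, the matrices \<open>b b\<^sup>T\<close> sum to \<open>Q\<close> of the subgraph induced by \<open>E\<close>, while the
  pockets raise the degrees of its vertices in \<open>F\<close> by \<open>r (m - 2)\<close>.
\<close>

section \<open>Matrices indexed by lists\<close>

text \<open>Labels from lists keep the entry function on vertices fixed while the ordering varies,
  and turn block decompositions into list append.\<close>

definition entry_mat :: "'i list \<Rightarrow> 'j list \<Rightarrow> ('i \<Rightarrow> 'j \<Rightarrow> 'c) \<Rightarrow> 'c mat" where
  "entry_mat xs ys f = mat (length xs) (length ys) (\<lambda>(i, j). f (xs ! i) (ys ! j))"

lemma entry_mat_carrier [simp]: "entry_mat xs ys f \<in> carrier_mat (length xs) (length ys)"
  and dim_row_entry_mat [simp]: "dim_row (entry_mat xs ys f) = length xs"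
  and dim_col_entry_mat [simp]: "dim_col (entry_mat xs ys f) = length ys"
  and index_entry_mat [simp]:
    "i < length xs \<Longrightarrow> j < length ys \<Longrightarrow> entry_mat xs ys f $$ (i, j) = f (xs ! i) (ys ! j)"
  by (auto simp: entry_mat_def)

lemma entry_mat_cong:
  assumes "\<And>a b. a \<in> set xs \<Longrightarrow> b \<in> set ys \<Longrightarrow> f a b = g a b"
  shows "entry_mat xs ys f = entry_mat xs ys g"
  by (rule eq_matI) (auto simp: assms)

lemma entry_mat_map: "entry_mat (map h xs) (map h' ys) f = entry_mat xs ys (\<lambda>a b. f (h a) (h' b))"
  by (rule eq_matI) auto

lemma entry_mat_append:
  "entry_mat (xs @ xs') (ys @ ys') f =
     four_block_mat (entry_mat xs ys f) (entry_mat xs ys' f)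
       (entry_mat xs' ys f) (entry_mat xs' ys' f)"
  by (rule eq_matI) (auto simp: nth_append)

section \<open>Determinants: simultaneous permutations and Schur complements\<close>

lemma det_permute_rows_cols:
  fixes A :: "'c :: comm_ring_1 mat"
  assumes A: "A \<in> carrier_mat n n" and q: "q permutes {0..<n}"
  shows "det (mat n n (\<lambda>(i, j). A $$ (q i, q j))) = det A"
proof -
  have lt: "q i < n" if "i < n" for i
    using permutes_in_image[OF q, of i] that by simp
  let ?B = "mat n n (\<lambda>(i, j). A $$ (q i, j))"
  \<comment> \<open>Columns are permuted by transposing, permuting rows and transposing back; the
    sign of \<open>q\<close> then occurs twice and squares to 1.\<close>
  have eq: "mat n n (\<lambda>(i, j). A $$ (q i, q j)) =
      (mat n n (\<lambda>(i, j). ?B\<^sup>T $$ (q i, j)))\<^sup>T"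
    by (rule eq_matI) (auto simp: lt)
  have "det (mat n n (\<lambda>(i, j). A $$ (q i, q j))) = signof q * det (?B\<^sup>T)"
    unfolding eq by (subst det_transpose[of _ n]) (auto intro!: det_permute_rows q)
  also have "det (?B\<^sup>T) = signof q * det A"
    by (subst det_transpose[of _ n]) (auto intro!: det_permute_rows A q)
  also have "signof q * (signof q * det A) = det A"
    by (simp add: sign_def)
  finally show ?thesis .
qed

text \<open>Repetition-free lists with the same elements differ by a permutation, which acts on rows
  and columns at once. An arbitrary ordering of the vertices of \<open>G\<close> may thus be
  exchanged for a convenient one.\<close>

lemma det_entry_mat_reorder:
  fixes f :: "'i \<Rightarrow> 'i \<Rightarrow> 'c :: comm_ring_1"
  assumes "distinct xs" "distinct ys" "set xs = set ys"
  shows "det (entry_mat xs xs f) = det (entry_mat ys ys f)"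
proof -
  have "mset xs = mset ys"
    using assms by (simp add: set_eq_iff_mset_eq_distinct)
  then obtain q where q: "q permutes {..<length ys}" and xs: "permute_list q ys = xs"
    by (rule mset_eq_permutation)
  have lt: "q i < length ys" if "i < length ys" for i
    using permutes_in_image[OF q, of i] that by simp
  have len: "length xs = length ys" using xs by auto
  have "entry_mat xs xs f =
      mat (length ys) (length ys) (\<lambda>(i, j). entry_mat ys ys f $$ (q i, q j))"
    by (rule eq_matI) (auto simp: lt len xs[symmetric] permute_list_nth[OF q])
  then show ?thesis
    using q det_permute_rows_cols[of "entry_mat ys ys f" "length ys" q]
    by (simp add: atLeast0LessThan)
qed

text \<open>Right multiplication by the unipotent matrix \<open>?L\<close> clears \<open>C\<close>
  and leaves the Schur complement in the upper left corner, so the product is block upper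
  triangular.\<close>

lemma det_four_block_mat_schur:
  fixes A :: "'c :: idom mat"
  assumes A: "A \<in> carrier_mat n n" and B: "B \<in> carrier_mat n m"
    and C: "C \<in> carrier_mat m n" and D: "D \<in> carrier_mat m m"
    and D': "D' \<in> carrier_mat m m" and inv: "D * D' = 1\<^sub>m m"
  shows "det (four_block_mat A B C D) = det D * det (A - B * D' * C)"
proof -
  let ?L = "four_block_mat (1\<^sub>m n) (0\<^sub>m n m) (- (D' * C)) (1\<^sub>m m)"
  have BDC: "B * (D' * C) = B * D' * C"
    using B D' C by (simp add: assoc_mult_mat)
  have DDC: "D * (D' * C) = C"
    using D D' C by (simp add: assoc_mult_mat[symmetric] inv)
  have carr: "D' * C \<in> carrier_mat m n" "B * D' * C \<in> carrier_mat n n"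
    using B C D' by auto
  have "four_block_mat A B C D * ?L =
      four_block_mat (A * 1\<^sub>m n + B * - (D' * C)) (A * 0\<^sub>m n m + B * 1\<^sub>m m)
        (C * 1\<^sub>m n + D * - (D' * C)) (C * 0\<^sub>m n m + D * 1\<^sub>m m)"
    using carr by (intro mult_four_block_mat[OF A B C D]) auto
  also have "A * 1\<^sub>m n + B * - (D' * C) = A - B * D' * C"
    using A B C D' carr by (simp add: BDC[symmetric] minus_add_uminus_mat[of _ n n])
  also have "A * 0\<^sub>m n m + B * 1\<^sub>m m = B"
    using A B by simp
  also have "C * 1\<^sub>m n + D * - (D' * C) = 0\<^sub>m m n"
    using C D D' carr by (simp add: DDC minus_add_uminus_mat[of C m n C, symmetric])
  also have "C * 0\<^sub>m n m + D * 1\<^sub>m m = D"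
    using C D by simp
  finally have "det (four_block_mat A B C D * ?L) = det (A - B * D' * C) * det D"
    using A B D carr
    by (simp add: det_four_block_mat_lower_left_zero[where n = n and m = m] minus_carrier_mat)
  moreover have "det (four_block_mat A B C D * ?L) = det (four_block_mat A B C D) * det ?L"
    using A D by (intro det_mult[of _ "n + m"]) auto
  moreover have "det ?L = 1"
    using C D' by (subst det_four_block_mat_upper_right_zero[of _ n _ m]) auto
  ultimately show ?thesis by simp
qed

text \<open>\<open>coronal\<close> is defined through \<open>the (mat_inverse _)\<close>, which is
  meaningful once an inverse is found; a nonzero determinant guarantees that.\<close>

lemma mat_inverse_Some:
  fixes A :: "'c :: field mat"
  assumes A: "A \<in> carrier_mat n n" and "det A \<noteq> 0"
  obtains B where "mat_inverse A = Some B" "A * B = 1\<^sub>m n" "B \<in> carrier_mat n n"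
proof -
  have "A \<in> Units (ring_mat TYPE('c) n ())"
    using assms by (rule det_non_zero_imp_unit)
  then obtain B where "mat_inverse A = Some B"
    using mat_inverse(1)[OF A, where b = "()"] by (cases "mat_inverse A") auto
  with mat_inverse(2)[OF A] that show thesis by blast
qed

text \<open>The block of the head edge comes last, so that one recursion step isolates a single
  pocket in the lower right corner, ready for a Schur complement.\<close>

fun pocket_order :: "'a list \<Rightarrow> 'b list \<Rightarrow> 'e list \<Rightarrow> ('a + 'e \<times> 'b) list" where
  "pocket_order xs ys [] = map Inl xs"
| "pocket_order xs ys (e # es) = pocket_order xs ys es @ map (\<lambda>w. Inr (e, w)) ys"

lemma set_pocket_order: "set (pocket_order xs ys es) = Inl ` set xs \<union> Inr ` (set es \<times> set ys)"
  by (induction es) auto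

lemma distinct_pocket_order:
  "distinct xs \<Longrightarrow> distinct ys \<Longrightarrow> distinct es \<Longrightarrow> distinct (pocket_order xs ys es)"
  by (induction es) (auto simp: distinct_map inj_on_def set_pocket_order)

text \<open>The outer factors are g 1^T and 1 g^T, so the product sees \<open>D\<close> only through
  the sum of its entries. When \<open>D\<close> inverts a pocket block, this sum is the
  coronal.\<close>

lemma row_col_ones_mult:
  fixes D :: "'c :: comm_ring_1 mat"
  assumes "D \<in> carrier_mat (length ys) (length ys)"
  shows "entry_mat zs ys (\<lambda>a w. g a) * D * entry_mat ys zs (\<lambda>w b. g b) =
    entry_mat zs zs (\<lambda>a b. g a * g b * (vec (length ys) (\<lambda>_. 1) \<bullet> (D *\<^sub>v vec (length ys) (\<lambda>_. 1))))"
proof (rule eq_matI, goal_cases)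
  case (1 i j)
  have "(entry_mat zs ys (\<lambda>a w. g a) * D * entry_mat ys zs (\<lambda>w b. g b)) $$ (i, j) =
      (\<Sum>l<length ys. (\<Sum>k<length ys. g (zs ! i) * D $$ (k, l)) * g (zs ! j))"
    using 1 assms by (auto simp: scalar_prod_def atLeast0LessThan intro!: sum.cong)
  also have "\<dots> = g (zs ! i) * g (zs ! j) * (\<Sum>l<length ys. \<Sum>k<length ys. D $$ (k, l))"
    by (simp add: sum_distrib_left sum_distrib_right mult_ac)
  also have "(\<Sum>l<length ys. \<Sum>k<length ys. D $$ (k, l)) = (\<Sum>k<length ys. \<Sum>l<length ys. D $$ (k, l))"
    by (rule sum.swap)
  finally show ?case
    using 1 assms by (simp add: scalar_prod_def atLeast0LessThan)
qed (use assms in auto)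

text \<open>The hypotheses abstract x I - Q(G): equal pocket blocks \<open>d\<close>, no interaction
  between different pockets, and a coupling \<open>g e a\<close> that is constant along a pocket.
  Each induction step takes one Schur complement; \<open>f\<close> is generalised because this
  changes the entries within \<open>F\<close>.\<close>

lemma det_pocket_order:
  fixes f :: "('a + 'e \<times> 'b) \<Rightarrow> ('a + 'e \<times> 'b) \<Rightarrow> 'c :: field"
  assumes D': "D' \<in> carrier_mat (length ys) (length ys)"
    and inv: "entry_mat ys ys d * D' = 1\<^sub>m (length ys)"
    and c: "c = vec (length ys) (\<lambda>_. 1) \<bullet> (D' *\<^sub>v vec (length ys) (\<lambda>_. 1))"
    and "distinct es"
    and "\<And>e e' w w'. \<lbrakk>e \<in> set es; e' \<in> set es; w \<in> set ys; w' \<in> set ys\<rbrakk> \<Longrightarrow>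
      f (Inr (e, w)) (Inr (e', w')) = (if e = e' then d w w' else 0)"
    and "\<And>a e w. \<lbrakk>a \<in> set xs; e \<in> set es; w \<in> set ys\<rbrakk> \<Longrightarrow> f (Inl a) (Inr (e, w)) = g e a"
    and "\<And>a e w. \<lbrakk>a \<in> set xs; e \<in> set es; w \<in> set ys\<rbrakk> \<Longrightarrow> f (Inr (e, w)) (Inl a) = g e a"
  shows "det (entry_mat (pocket_order xs ys es) (pocket_order xs ys es) f) =
    det (entry_mat ys ys d) ^ length es *
    det (entry_mat xs xs (\<lambda>a b. f (Inl a) (Inl b) - c * (\<Sum>e\<in>set es. g e a * g e b)))"
  using assms(4-)
proof (induction es arbitrary: f)
  case Nil
  then show ?case by (simp add: entry_mat_map)
next
  case (Cons e es)
  let ?zs = "pocket_order xs ys es"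
  let ?es = "map (\<lambda>w. Inr (e, w)) ys :: ('a + 'e \<times> 'b) list"
  \<comment> \<open>\<open>h\<close> couples the remaining vertices to the pocket at
    \<open>e\<close> and is zero on the other pockets; \<open>f'\<close> is the entry function of
    the Schur complement.\<close>
  define h :: "'a + 'e \<times> 'b \<Rightarrow> 'c" where "h = case_sum (g e) (\<lambda>_. 0)"
  define f' where "f' a b = f a b - h a * h b * c" for a b
  note f1 = Cons.prems(2) and f2 = Cons.prems(3) and f3 = Cons.prems(4)
  have B: "entry_mat ?zs ?es f = entry_mat ?zs ys (\<lambda>a w. h a)"
  proof (rule eq_matI, goal_cases)
    case (1 i j)
    then have "?zs ! i \<in> set ?zs" "ys ! j \<in> set ys" by auto
    then have "f (?zs ! i) (Inr (e, ys ! j)) = h (?zs ! i)"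
      using \<open>distinct (e # es)\<close> unfolding set_pocket_order h_def by (auto simp: f1 f2)
    with 1 show ?case by simp
  qed auto
  have C: "entry_mat ?es ?zs f = entry_mat ys ?zs (\<lambda>w b. h b)"
  proof (rule eq_matI, goal_cases)
    case (1 i j)
    then have "?zs ! j \<in> set ?zs" "ys ! i \<in> set ys" by auto
    then have "f (Inr (e, ys ! i)) (?zs ! j) = h (?zs ! j)"
      using \<open>distinct (e # es)\<close> unfolding set_pocket_order h_def by (auto simp: f1 f3)
    with 1 show ?case by simp
  qed auto
  have D: "entry_mat ?es ?es f = entry_mat ys ys d"
    unfolding entry_mat_map by (rule entry_mat_cong) (auto simp: f1)
  have "det (entry_mat (pocket_order xs ys (e # es)) (pocket_order xs ys (e # es)) f) =
      det (entry_mat ys ys d) * det (entry_mat ?zs ?zs f -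
        entry_mat ?zs ys (\<lambda>a w. h a) * D' * entry_mat ys ?zs (\<lambda>w b. h b))"
    unfolding pocket_order.simps entry_mat_append B C D
    by (rule det_four_block_mat_schur[OF _ _ _ _ D' inv]) auto
  also have "entry_mat ?zs ?zs f -
        entry_mat ?zs ys (\<lambda>a w. h a) * D' * entry_mat ys ?zs (\<lambda>w b. h b) = entry_mat ?zs ?zs f'"
    unfolding row_col_ones_mult[OF D'] c[symmetric] by (rule eq_matI) (auto simp: f'_def)
  \<comment> \<open>Since \<open>h\<close> vanishes on pocket vertices, \<open>f'\<close> differs
    from \<open>f\<close> only between vertices of \<open>F\<close>, and the induction hypothesis
    applies to it.\<close>
  also have "det (entry_mat ?zs ?zs f') = det (entry_mat ys ys d) ^ length es *
      det (entry_mat xs xs (\<lambda>a b. f' (Inl a) (Inl b) - c * (\<Sum>e\<in>set es. g e a * g e b)))"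
    using Cons.prems(1) by (intro Cons.IH) (auto simp: f'_def h_def f1 f2 f3)
  also have "(\<lambda>a b. f' (Inl a) (Inl b) - c * (\<Sum>e\<in>set es. g e a * g e b)) =
      (\<lambda>a b. f (Inl a) (Inl b) - c * (\<Sum>e\<in>set (e # es). g e a * g e b))"
    using Cons.prems(1) by (auto simp: f'_def h_def algebra_simps)
  finally show ?case by simp
qed

section \<open>Graphs with edge-pockets\<close>

text \<open>An edge at \<open>x\<close> has exactly one other end, so edges at \<open>x\<close>
  correspond to neighbours, which are easier to sort by type in the pocket graph.\<close>

lemma vertex_degree_eq_card_neighbours:
  assumes "\<And>e. e \<in> edges G \<Longrightarrow> card e = 2"
  shows "vertex_degree G x = card {y. {x, y} \<in> edges G}"
proof -
  have "bij_betw (\<lambda>y. {x, y}) {y. {x, y} \<in> edges G} {e \<in> edges G. x \<in> e}"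
  proof (rule bij_betw_imageI)
    show "inj_on (\<lambda>y. {x, y}) {y. {x, y} \<in> edges G}"
      by (auto simp: inj_on_def doubleton_eq_iff)
    show "(\<lambda>y. {x, y}) ` {y. {x, y} \<in> edges G} = {e \<in> edges G. x \<in> e}"
    proof (intro equalityI subsetI)
      fix e assume "e \<in> {e \<in> edges G. x \<in> e}"
      then have e: "e \<in> edges G" "x \<in> e" "card e = 2" using assms by auto
      then obtain a b where "e = {a, b}" by (auto simp: card_2_iff)
      with e obtain y where "e = {x, y}" by blast
      with e show "e \<in> (\<lambda>y. {x, y}) ` {y. {x, y} \<in> edges G}" by auto
    qed auto
  qed
  then show ?thesis
    unfolding vertex_degree_def by (simp add: bij_betw_same_card)
qed

text \<open>The neighbours of \<open>x\<close> lie among the other vertices and are equally many,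
  hence are all of them. This turns the degree m - 1 of \<open>u\<close> and \<open>v\<close> into
  adjacency.\<close>

lemma universal_vertex_adjacent:
  assumes G: "simple_graph G" and deg: "vertex_degree G x = card (verts G) - 1"
    and "x \<in> verts G" "y \<in> verts G" "y \<noteq> x"
  shows "{x, y} \<in> edges G"
proof -
  have fin: "finite (verts G)" and e2: "\<And>e. e \<in> edges G \<Longrightarrow> e \<subseteq> verts G \<and> card e = 2"
    using G by (auto simp: simple_graph_def)
  have "{z. {x, z} \<in> edges G} \<subseteq> verts G - {x}"
    using e2 by fastforce
  moreover have "card {z. {x, z} \<in> edges G} = card (verts G - {x})"
    using e2 deg \<open>x \<in> verts G\<close> fin by (simp add: vertex_degree_eq_card_neighbours[symmetric])
  ultimately have "{z. {x, z} \<in> edges G} = verts G - {x}"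
    using fin by (intro card_subset_eq) auto
  then show ?thesis using assms by auto
qed

definition signless_entry :: "'a sgraph \<Rightarrow> 'a \<Rightarrow> 'a \<Rightarrow> real" where
  "signless_entry G a b =
     (if a = b then real (vertex_degree G a) else 0) + (if {a, b} \<in> edges G then 1 else 0)"

lemma signless_laplacian_eq_entry_mat:
  "distinct xs \<Longrightarrow> signless_laplacian xs G = entry_mat xs xs (signless_entry G)"
  by (rule eq_matI)
    (auto simp: signless_laplacian_def degree_mat_def adjacency_mat_def signless_entry_def
      nth_eq_iff_index_eq)

text \<open>This is the factorisation Q = B B^T with the vertex-edge incidence matrix B: the
  diagonal counts edges at a vertex, and two different vertices share at most the edge joining them.
  It turns the sum of rank one corrections into Q of the induced subgraph.\<close>

lemma signless_entry_edge_induced: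
  assumes "finite E" and E2: "\<And>e. e \<in> E \<Longrightarrow> card e = 2"
  shows "signless_entry (edge_induced E) a b = (\<Sum>e\<in>E. of_bool (a \<in> e) * of_bool (b \<in> e))"
proof -
  have "(\<Sum>e\<in>E. of_bool (a \<in> e) * of_bool (b \<in> e) :: real) = card {e \<in> E. a \<in> e \<and> b \<in> e}"
    using \<open>finite E\<close> unfolding of_bool_conj[symmetric]
    by (simp add: Int_def del: of_bool_conj)
  also have "\<dots> = signless_entry (edge_induced E) a b"
  proof (cases "a = b")
    case True
    have "{a} \<notin> E" using E2[of "{a}"] by auto
    with True show ?thesis
      by (simp add: signless_entry_def edge_induced_def vertex_degree_def)
  next
    case False
    have "e = {a, b}" if "e \<in> E" "a \<in> e" "b \<in> e" for e
    proof -
      have "finite e" "card e = card {a, b}"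
        using E2[OF \<open>e \<in> E\<close>] False by (auto intro: card_ge_0_finite)
      then show ?thesis
        using that by (intro card_subset_eq[symmetric]) auto
    qed
    then have "{e \<in> E. a \<in> e \<and> b \<in> e} \<subseteq> {{a, b}}" by blast
    then have "{e \<in> E. a \<in> e \<and> b \<in> e} = (if {a, b} \<in> E then {{a, b}} else {})"
      by auto
    with False show ?thesis by (simp add: signless_entry_def edge_induced_def)
  qed
  finally show ?thesis by (rule sym)
qed

text \<open>Handshake lemma, by counting incidences in two ways; for an r-regular subgraph on p
  vertices it gives p r = 2 k.\<close>

lemma sum_vertex_degree_edge_induced:
  assumes "finite E" and E2: "\<And>e. e \<in> E \<Longrightarrow> card e = 2"
  shows "(\<Sum>x\<in>\<Union>E. vertex_degree (edge_induced E) x) = 2 * card E"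
proof -
  have fin: "finite (\<Union>E)"
    using assms by (intro finite_Union) (auto intro: card_ge_0_finite)
  have "(\<Sum>x\<in>\<Union>E. vertex_degree (edge_induced E) x) = (\<Sum>x\<in>\<Union>E. \<Sum>e\<in>E. of_bool (x \<in> e))"
    using \<open>finite E\<close>
    by (simp add: vertex_degree_def edge_induced_def sum_of_bool_eq Int_def)
  also have "\<dots> = (\<Sum>e\<in>E. \<Sum>x\<in>\<Union>E. of_bool (x \<in> e))"
    by (rule sum.swap)
  also have "\<dots> = (\<Sum>e\<in>E. card e)"
  proof (rule sum.cong)
    fix e assume "e \<in> E"
    then have "\<Union>E \<inter> e = e" by auto
    with fin show "(\<Sum>x\<in>\<Union>E. of_bool (x \<in> e)) = card e"
      by (simp add: sum_of_bool_eq)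
  qed simp
  also have "\<dots> = 2 * card E" using E2 by simp
  finally show ?thesis .
qed

text \<open>The degree conditions on \<open>u\<close> and \<open>v\<close> appear here as adjacency
  to every other vertex of \<open>H\<close>, the form in which the edges of the pocket graph use
  them.\<close>

locale edge_pockets =
  fixes F :: "'a sgraph" and E :: "'a set set" and H :: "'b sgraph" and u v :: 'b
    and s t :: "'a set \<Rightarrow> 'a"
  assumes F: "simple_graph F" and E: "E \<subseteq> edges F" and H: "simple_graph H"
    and uv: "{u, v} \<in> edges H"
    and adj_u: "\<And>w. w \<in> verts H - {u, v} \<Longrightarrow> {u, w} \<in> edges H"
    and adj_v: "\<And>w. w \<in> verts H - {u, v} \<Longrightarrow> {v, w} \<in> edges H"
    and ends: "\<And>e. e \<in> E \<Longrightarrow> e = {s e, t e}"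
begin

abbreviation G :: "('a + 'a set \<times> 'b) sgraph" where
  "G \<equiv> edge_pocket_graph F E H u v s t"

abbreviation H\<^sub>2 :: "'b sgraph" where
  "H\<^sub>2 \<equiv> delete_verts H {u, v}"

section \<open>Vertices and edges of the pocket graph\<close>

lemma finite_E: "finite E"
proof -
  have "edges F \<subseteq> Pow (verts F)" "finite (verts F)" using F by (auto simp: simple_graph_def)
  then show ?thesis using E by (meson finite_Pow_iff finite_subset)
qed

lemma card_E: "e \<in> E \<Longrightarrow> card e = 2"
  using F E by (auto simp: simple_graph_def)

lemma u_neq_v: "u \<noteq> v"
  using uv H by (fastforce simp: simple_graph_def)

lemma u_v_in_verts: "u \<in> verts H" "v \<in> verts H"
  using uv H by (fastforce simp: simple_graph_def)+

lemma ends_in: "e \<in> E \<Longrightarrow> s e \<in> e" "e \<in> E \<Longrightarrow> t e \<in> e"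
  using ends by (metis insertI1, metis insertI1 insertI2)

text \<open>In each copy \<open>u\<close> and \<open>v\<close> fall on ends of an edge of
  \<open>F\<close>, so only the copies of \<open>H\<^sub>2\<close> contribute new vertices.\<close>

lemma verts_G: "verts G = Inl ` verts F \<union> Inr ` (E \<times> verts H\<^sub>2)"
proof -
  have st: "s e \<in> verts F" "t e \<in> verts F" if "e \<in> E" for e
  proof -
    have "e \<subseteq> verts F" using F E that by (auto simp: simple_graph_def)
    then show "s e \<in> verts F" "t e \<in> verts F" using ends_in[OF that] by (simp_all only: subsetD)
  qed
  have "pocket_map u v s t e ` verts H = {Inl (s e), Inl (t e)} \<union> (\<lambda>w. Inr (e, w)) ` verts H\<^sub>2" for e
  proof -
    have "verts H = {u, v} \<union> verts H\<^sub>2"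
      using u_v_in_verts by (auto simp: delete_verts_def)
    moreover have "pocket_map u v s t e ` verts H\<^sub>2 = (\<lambda>w. Inr (e, w)) ` verts H\<^sub>2"
      by (rule image_cong) (auto simp: pocket_map_def delete_verts_def)
    ultimately show ?thesis
      using u_neq_v by (simp only: image_Un) (simp add: pocket_map_def insert_commute)
  qed
  then show ?thesis
    using st unfolding edge_pocket_graph_def by auto
qed

lemma edge_H_cases:
  assumes "d \<in> edges H"
  obtains "d = {u, v}"
    | w where "w \<in> verts H\<^sub>2" "d = {u, w}"
    | w where "w \<in> verts H\<^sub>2" "d = {v, w}"
    | "d \<in> edges H\<^sub>2"
proof -
  have "card d = 2" "d \<subseteq> verts H" using assms H by (auto simp: simple_graph_def)
  then obtain a b where "d = {a, b}" "a \<noteq> b" "a \<in> verts H" "b \<in> verts H"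
    by (auto simp: card_2_iff)
  then show thesis using assms that unfolding delete_verts_def
    by (cases "a = u"; cases "a = v"; cases "b = u"; cases "b = v") (auto simp: insert_commute)
qed

text \<open>As \<open>u\<close> and \<open>v\<close> are both joined to all of
  \<open>H\<^sub>2\<close>, each pocket joins both ends of \<open>e\<close> to its whole copy of
  \<open>H\<^sub>2\<close>. Hence the orientation chosen by \<open>s\<close> and \<open>t\<close>
  leaves no trace on the right-hand side.\<close>

lemma edges_G:
  "edges G = (`) Inl ` edges F \<union> {{Inl a, Inr (e, w)} |a e w. e \<in> E \<and> a \<in> e \<and> w \<in> verts H\<^sub>2} \<union>
     (\<Union>e\<in>E. (\<lambda>d. (\<lambda>w. Inr (e, w)) ` d) ` edges H\<^sub>2)" (is "_ = ?R")
proof (intro equalityI subsetI)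
  let ?f = "pocket_map u v s t"
  have pu: "?f e u = Inl (s e)" and pv: "?f e v = Inl (t e)" for e
    using u_neq_v by (auto simp: pocket_map_def)
  have pw: "?f e w = Inr (e, w)" if "w \<in> verts H\<^sub>2" for e w
    using that by (auto simp: pocket_map_def delete_verts_def)
  have pd: "?f e ` d = (\<lambda>w. Inr (e, w)) ` d" if "d \<in> edges H\<^sub>2" for e d
    using that by (auto simp: pocket_map_def delete_verts_def intro!: image_cong)
  have pe: "?f e ` d \<in> edges G" if "e \<in> E" "d \<in> edges H" for e d
    using that unfolding edge_pocket_graph_def by simp blast
  {
    fix D assume "D \<in> edges G"
    then consider "D \<in> (`) Inl ` edges F"
      | e d where "e \<in> E" "d \<in> edges H" "D = ?f e ` d"
      by (auto simp: edge_pocket_graph_def)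
    then show "D \<in> ?R"
    proof cases
      case 1
      then show ?thesis by (intro UnI1)
    next
      case 2
      from \<open>d \<in> edges H\<close> show ?thesis
      proof (cases rule: edge_H_cases)
        case 1
        \<comment> \<open>The copy of the edge uv is pasted onto \<open>e\<close>, which
          \<open>F\<close> already has.\<close>
        then have "D = Inl ` {s e, t e}" using 2 by (simp add: pu pv)
        then have "D = Inl ` e" by (simp only: ends[OF \<open>e \<in> E\<close>, symmetric])
        then show ?thesis using 2 E by auto
      next
        case (2 w)
        then have "D = {Inl (s e), Inr (e, w)}" using \<open>D = _\<close> by (simp add: pu pw)
        moreover have "s e \<in> e" using ends_in \<open>e \<in> E\<close> by simp
        ultimately show ?thesis
          using 2(1) \<open>e \<in> E\<close> by (intro UnI1[OF UnI2] CollectI) blast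
      next
        case (3 w)
        then have "D = {Inl (t e), Inr (e, w)}" using \<open>D = _\<close> by (simp add: pv pw)
        moreover have "t e \<in> e" using ends_in \<open>e \<in> E\<close> by simp
        ultimately show ?thesis
          using 3(1) \<open>e \<in> E\<close> by (intro UnI1[OF UnI2] CollectI) blast
      next
        case 4
        then have "D = (\<lambda>w. Inr (e, w)) ` d" using \<open>D = _\<close> by (simp only: pd)
        then show ?thesis using 4 \<open>e \<in> E\<close> by (intro UnI2 UN_I[of e] imageI) simp_all
      qed
    qed
  next
    fix D assume "D \<in> ?R"
    then consider "D \<in> (`) Inl ` edges F"
      | a e w where "D = {Inl a, Inr (e, w)}" "e \<in> E" "a \<in> e" "w \<in> verts H\<^sub>2"
      | e d where "e \<in> E" "d \<in> edges H\<^sub>2" "D = (\<lambda>w. Inr (e, w)) ` d"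
      by (elim UnE UN_E CollectE exE conjE imageE) blast+
    then show "D \<in> edges G"
    proof cases
      case 1
      then show ?thesis by (auto simp: edge_pocket_graph_def)
    next
      case 2
      have w: "w \<in> verts H - {u, v}" using 2 by (simp add: delete_verts_def)
      have "a = s e \<or> a = t e" using 2 ends[of e] by (metis empty_iff insert_iff)
      then have "D = ?f e ` {u, w} \<or> D = ?f e ` {v, w}"
        using \<open>D = _\<close> \<open>w \<in> verts H\<^sub>2\<close> by (elim disjE) (simp_all add: pu pv pw)
      then show ?thesis
        using pe[OF \<open>e \<in> E\<close> adj_u[OF w]] pe[OF \<open>e \<in> E\<close> adj_v[OF w]] by (elim disjE) simp_all
    next
      case 3
      then have "D = ?f e ` d" "d \<in> edges H"
        by (simp_all add: pd) (simp add: delete_verts_def)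
      then show ?thesis using pe[OF 3(1)] by simp
    qed
  }
qed

section \<open>Adjacency and degrees in the pocket graph\<close>

lemma card_edge_H2: "d \<in> edges H\<^sub>2 \<Longrightarrow> card d = 2"
  using H by (auto simp: simple_graph_def delete_verts_def)

lemma card_edge_F: "d \<in> edges F \<Longrightarrow> card d = 2"
  using F by (auto simp: simple_graph_def)

lemma card_edge_G: "D \<in> edges G \<Longrightarrow> card D = 2"
  unfolding edges_G by (auto simp: card_image inj_on_def card_edge_F card_edge_H2)

lemma edge_G_Inl_Inl: "{Inl a, Inl b} \<in> edges G \<longleftrightarrow> {a, b} \<in> edges F"
proof
  assume "{Inl a, Inl b} \<in> edges G"
  then consider d where "d \<in> edges F" "{Inl a, Inl b} = (Inl ` d :: ('a + 'a set \<times> 'b) set)"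
    | e d where "{Inl a, Inl b} = (\<lambda>w. Inr (e, w)) ` d"
    unfolding edges_G by (auto simp: doubleton_eq_iff)
  then show "{a, b} \<in> edges F"
  proof cases
    case 1
    then have "Inl ` {a, b} = (Inl ` d :: ('a + 'a set \<times> 'b) set)" by simp
    then have "{a, b} = d" by (subst (asm) inj_image_eq_iff) auto
    with 1 show ?thesis by simp
  qed auto
next
  assume "{a, b} \<in> edges F"
  moreover have "{Inl a, Inl b} = Inl ` {a, b}" by simp
  ultimately show "{Inl a, Inl b} \<in> edges G" unfolding edges_G by blast
qed

lemma edge_G_Inl_Inr: "{Inl a, Inr (e, w)} \<in> edges G \<longleftrightarrow> e \<in> E \<and> a \<in> e \<and> w \<in> verts H\<^sub>2"
proof
  assume "{Inl a, Inr (e, w)} \<in> edges G"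
  moreover have "{Inl a, Inr (e, w)} \<noteq> Inl ` d" for d :: "'a set" by auto
  moreover have "{Inl a, Inr (e, w)} \<noteq> (\<lambda>w. Inr (e', w)) ` d" for e' :: "'a set" and d :: "'b set"
    by auto
  ultimately show "e \<in> E \<and> a \<in> e \<and> w \<in> verts H\<^sub>2"
    unfolding edges_G by (auto simp: doubleton_eq_iff)
qed (auto simp: edges_G)

lemma edge_G_Inr_Inr:
  "{Inr (e, w), Inr (e', w')} \<in> edges G \<longleftrightarrow> e = e' \<and> e \<in> E \<and> {w, w'} \<in> edges H\<^sub>2"
proof
  assume "{Inr (e, w), Inr (e', w')} \<in> edges G"
  then obtain e'' d where d: "e'' \<in> E" "d \<in> edges H\<^sub>2"
    "{Inr (e, w), Inr (e', w')} = (\<lambda>w. (Inr (e'', w) :: 'a + 'a set \<times> 'b)) ` d"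
    unfolding edges_G by (auto simp: doubleton_eq_iff)
  have "Inr (e, w) \<in> {Inr (e, w), Inr (e', w') :: 'a + 'a set \<times> 'b}"
    "Inr (e', w') \<in> {Inr (e, w), Inr (e', w') :: 'a + 'a set \<times> 'b}" by simp_all
  then have e: "e = e''" "e' = e''" unfolding d(3) by (blast, blast)
  with d have "(\<lambda>w. (Inr (e'', w) :: 'a + 'a set \<times> 'b)) ` {w, w'} = (\<lambda>w. Inr (e'', w)) ` d"
    by simp
  then have "{w, w'} = d" by (subst (asm) inj_image_eq_iff) (auto simp: inj_on_def)
  with d e show "e = e' \<and> e \<in> E \<and> {w, w'} \<in> edges H\<^sub>2" by simp
next
  assume "e = e' \<and> e \<in> E \<and> {w, w'} \<in> edges H\<^sub>2"
  then have *: "e' = e" "e \<in> E" "{w, w'} \<in> edges H\<^sub>2" by blast+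
  from *(2,3) have "(\<lambda>w. Inr (e, w)) ` {w, w'} \<in> edges G"
    unfolding edges_G by (intro UnI2 UN_I[of e] imageI) simp_all
  with *(1) show "{Inr (e, w), Inr (e', w')} \<in> edges G" by simp
qed

lemma edge_G_Inr_Inl: "{Inr (e, w), Inl a} \<in> edges G \<longleftrightarrow> e \<in> E \<and> a \<in> e \<and> w \<in> verts H\<^sub>2"
  using edge_G_Inl_Inr by (simp add: insert_commute)

text \<open>Beyond its neighbours in \<open>F\<close>, the vertex sees one full copy of
  \<open>H\<^sub>2\<close> for each edge of \<open>E\<close> that contains it.\<close>

lemma vertex_degree_G_Inl:
  "vertex_degree G (Inl a) =
     vertex_degree F a + vertex_degree (edge_induced E) a * card (verts H\<^sub>2)"
proof -
  have "{y. {Inl a, y} \<in> edges G} =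
      Inl ` {b. {a, b} \<in> edges F} \<union> Inr ` ({e \<in> E. a \<in> e} \<times> verts H\<^sub>2)" (is "?N = ?A \<union> ?B")
  proof (rule Set.set_eqI)
    fix y show "y \<in> ?N \<longleftrightarrow> y \<in> ?A \<union> ?B"
      by (cases y) (auto simp: edge_G_Inl_Inl edge_G_Inl_Inr)
  qed
  moreover have "finite ?A"
  proof -
    have "{b. {a, b} \<in> edges F} \<subseteq> verts F" "finite (verts F)"
      using F by (auto simp: simple_graph_def)
    then show ?thesis using finite_subset by blast
  qed
  moreover have "finite ?B"
    using finite_E H by (auto simp: simple_graph_def delete_verts_def)
  ultimately have "card {y. {Inl a, y} \<in> edges G} = card ?A + card ?B"
    by (simp only:) (rule card_Un_disjoint, auto)
  moreover have "vertex_degree (edge_induced E) a = card {e \<in> E. a \<in> e}"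
    by (simp add: vertex_degree_def edge_induced_def)
  moreover have "vertex_degree G (Inl a) = card {y. {Inl a, y} \<in> edges G}"
    by (rule vertex_degree_eq_card_neighbours[OF card_edge_G])
  moreover have "vertex_degree F a = card {b. {a, b} \<in> edges F}"
    by (rule vertex_degree_eq_card_neighbours[OF card_edge_F])
  ultimately show ?thesis
    by (simp only: card_image[OF inj_Inl] card_image[OF inj_Inr] card_cartesian_product)
qed

text \<open>The extra 2 counts the two ends of \<open>e\<close>; it is the source of the shift from
  x to x - 2.\<close>

lemma vertex_degree_G_Inr:
  assumes "e \<in> E" "w \<in> verts H\<^sub>2"
  shows "vertex_degree G (Inr (e, w)) = 2 + vertex_degree H\<^sub>2 w"
proof -
  have "{y. {Inr (e, w), y} \<in> edges G} =
      Inl ` e \<union> Inr ` ({e} \<times> {w'. {w, w'} \<in> edges H\<^sub>2})" (is "?N = ?A \<union> ?B")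
  proof (rule Set.set_eqI)
    fix y show "y \<in> ?N \<longleftrightarrow> y \<in> ?A \<union> ?B"
      using assms by (cases y) (auto simp: edge_G_Inr_Inl edge_G_Inr_Inr)
  qed
  moreover have "finite ?A"
    using card_E[OF assms(1)] by (auto intro: card_ge_0_finite)
  moreover have "finite ?B"
  proof -
    have "{w'. {w, w'} \<in> edges H\<^sub>2} \<subseteq> verts H" "finite (verts H)"
      using H by (auto simp: simple_graph_def delete_verts_def)
    then show ?thesis using finite_subset by blast
  qed
  ultimately have "card {y. {Inr (e, w), y} \<in> edges G} = card ?A + card ?B"
    by (simp only:) (rule card_Un_disjoint, auto)
  moreover have "vertex_degree G (Inr (e, w)) = card {y. {Inr (e, w), y} \<in> edges G}"
    by (rule vertex_degree_eq_card_neighbours[OF card_edge_G])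
  moreover have "vertex_degree H\<^sub>2 w = card {w'. {w, w'} \<in> edges H\<^sub>2}"
    by (rule vertex_degree_eq_card_neighbours[OF card_edge_H2])
  ultimately show ?thesis
    using card_E[OF assms(1)]
    by (simp only: card_image[OF inj_Inl] card_image[OF inj_Inr] card_cartesian_product) simp
qed

section \<open>Blocks of the signless Laplacian of the pocket graph\<close>

lemma signless_entry_G_Inl_Inl:
  "signless_entry G (Inl a) (Inl b) = signless_entry F a b +
     (if a = b then real (vertex_degree (edge_induced E) a * card (verts H\<^sub>2)) else 0)"
  using edge_G_Inl_Inl[of a b] by (auto simp: signless_entry_def vertex_degree_G_Inl)

lemma signless_entry_G_Inl_Inr:
  assumes "e \<in> E" "w \<in> verts H\<^sub>2"
  shows "signless_entry G (Inl a) (Inr (e, w)) = of_bool (a \<in> e)"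
    and "signless_entry G (Inr (e, w)) (Inl a) = of_bool (a \<in> e)"
  using assms by (auto simp: signless_entry_def edge_G_Inl_Inr edge_G_Inr_Inl)

lemma signless_entry_G_Inr_Inr:
  assumes "e \<in> E" "e' \<in> E" "w \<in> verts H\<^sub>2" "w' \<in> verts H\<^sub>2"
  shows "signless_entry G (Inr (e, w)) (Inr (e', w')) =
    (if e = e' then signless_entry H\<^sub>2 w w' + (if w = w' then 2 else 0) else 0)"
  using assms edge_G_Inr_Inr[of e w e' w'] by (auto simp: signless_entry_def vertex_degree_G_Inr)

end

section \<open>Characteristic polynomials over the rational functions\<close>

text \<open>Links the two forms of the shift: the argument of the coronal and the polynomial
  composed with the characteristic polynomial.\<close>

lemma rf_X_minus_2: "rf_X - 2 = to_fract [:- 2, 1:]"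
proof -
  have "(2 :: ratfun) = to_fract [:2:]"
    by (metis numeral_poly to_fract_hom.hom_numeral)
  then have "rf_X - 2 = to_fract ([:0, 1:] - [:2:])"
    by (simp only: rf_X_def to_fract_hom.hom_minus)
  then show ?thesis by simp
qed

lemma rf_const_hom [simp]:
  "rf_const 0 = 0" "rf_const 1 = 1" "rf_const (a + b) = rf_const a + rf_const b"
  "rf_const (a * b) = rf_const a * rf_const b" "rf_const (- a) = - rf_const a"
  by (simp_all add: rf_const_def to_fract_hom.hom_add[symmetric] to_fract_hom.hom_mult[symmetric]
      to_fract_hom.hom_uminus[symmetric] pCons_one[symmetric] del: pCons_one)

lemma rf_const_of_nat [simp]: "rf_const (of_nat k) = of_nat k"
  by (induction k) simp_all

lemma rf_const_sum: "rf_const (sum f A) = (\<Sum>x\<in>A. rf_const (f x))"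
  by (induction A rule: infinite_finite_induct) simp_all

text \<open>Substituting \<open>q\<close> and then embedding into the rational functions is a ring
  homomorphism, so it passes through the determinant that defines \<open>char_poly\<close>.\<close>

lemma to_fract_char_poly_pcompose:
  assumes "distinct xs"
  shows "to_fract (char_poly (entry_mat xs xs h) \<circ>\<^sub>p q) =
    det (entry_mat xs xs (\<lambda>a b. (if a = b then to_fract q else 0) - rf_const (h a b)))"
proof -
  let ?N = "entry_mat xs xs h"
  have hom: "comm_ring_hom (\<lambda>r :: real poly. to_fract (r \<circ>\<^sub>p q))"
    by unfold_locales (simp_all add: pcompose_add pcompose_mult)
  have "map_mat (\<lambda>r. to_fract (r \<circ>\<^sub>p q)) (char_poly_matrix ?N) =
      entry_mat xs xs (\<lambda>a b. (if a = b then to_fract q else 0) - rf_const (h a b))"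
  proof (rule eq_matI, goal_cases)
    case (1 i j)
    then have ij: "i < length xs" "j < length xs" by simp_all
    then have "char_poly_matrix ?N $$ (i, j) =
        (if i = j then [:0, 1:] else 0) + [:- h (xs ! i) (xs ! j):]"
      by (simp add: char_poly_matrix_def)
    moreover have "to_fract (((if i = j then [:0, 1:] else 0) + [:- h (xs ! i) (xs ! j):]) \<circ>\<^sub>p q) =
        (if i = j then to_fract q else 0) + rf_const (- h (xs ! i) (xs ! j))"
      by (simp add: pcompose_add pcompose_idR rf_const_def pcompose_pCons)
    moreover have "dim_row (char_poly_matrix ?N) = length xs" "dim_col (char_poly_matrix ?N) = length xs"
      by (simp_all add: char_poly_matrix_def)
    ultimately show ?case
      using ij assms by (simp add: nth_eq_iff_index_eq)
  qed (simp_all add: char_poly_matrix_def)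
  then show ?thesis
    unfolding char_poly_def by (simp only: comm_ring_hom.hom_det[OF hom, symmetric])
qed

lemma to_fract_char_poly:
  assumes "distinct xs"
  shows "to_fract (char_poly (entry_mat xs xs h)) =
    det (entry_mat xs xs (\<lambda>a b. (if a = b then rf_X else 0) - rf_const (h a b)))"
  using to_fract_char_poly_pcompose[OF assms, of h "[:0, 1:]"]
  unfolding pcompose_idR rf_X_def[symmetric] .

lemma index_corner_block:
  assumes "A \<in> carrier_mat p p" "p \<le> n" "i < n" "j < n"
  shows "corner_block n A $$ (i, j) = (if i < p \<and> j < p then A $$ (i, j) else 0)"
  using assms by (auto simp: corner_block_def Let_def)

lemma corner_block_carrier:
  "A \<in> carrier_mat p p \<Longrightarrow> p \<le> n \<Longrightarrow> corner_block n A \<in> carrier_mat n n"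
  unfolding corner_block_def Let_def by (rule carrier_matI) auto

section \<open>Assembling the characteristic polynomial of the pocket graph\<close>

theorem proposition4p1:
  fixes F :: "'a sgraph" and E :: "'a set set" and H H2 :: "'b sgraph" and u v :: 'b
    and s t :: "'a set \<Rightarrow> 'a" and G :: "('a + 'a set \<times> 'b) sgraph"
    and n m k r p :: nat and xs :: "'a list" and ys :: "'b list" and zs :: "('a + 'a set \<times> 'b) list"
    and M :: "ratfun mat"
  assumes F: "simple_graph F" "card (verts F) = n" "n \<ge> 2"
    and E: "E \<subseteq> edges F" "card E = k"
    and reg: "regular_graph (edge_induced E) r"
    and p: "p = card (verts (edge_induced E))"
    and H: "simple_graph H" "card (verts H) = m" "m \<ge> 3"
    and uv: "{u, v} \<in> edges H" "vertex_degree H u = m - 1" "vertex_degree H v = m - 1"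
    and ends: "\<forall>e\<in>E. e = {s e, t e}"
    and H2: "H2 = delete_verts H {u, v}"
    and G: "G = edge_pocket_graph F E H u v s t"
    and xs: "vertex_ordering xs F" "set (take p xs) = verts (edge_induced E)"
    and ys: "vertex_ordering ys H2"
    and zs: "vertex_ordering zs G"
    and M: "M = map_mat rf_const (signless_laplacian xs F)
              + of_nat (r * (m - 2)) \<cdot>\<^sub>m corner_block n (1\<^sub>m p)
              + coronal (signless_laplacian ys H2) (rf_X - 2) \<cdot>\<^sub>m
                  corner_block n (map_mat rf_const
                    (signless_laplacian (take p xs) (edge_induced E)))"
  shows "real p = 2 * real k / real r \<and>
    to_fract (char_poly (signless_laplacian zs G)) =
      to_fract (char_poly (signless_laplacian ys H2) \<circ>\<^sub>p [:- 2, 1:]) ^ k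
        * det (rf_X \<cdot>\<^sub>m 1\<^sub>m n - M)"
proof
  have uvH: "u \<in> verts H" "v \<in> verts H"
    using uv(1) H(1) by (fastforce simp: simple_graph_def)+
  interpret P: edge_pockets F E H u v s t
    using F E H uv ends uvH
    by unfold_locales (auto intro!: universal_vertex_adjacent)
  have VE: "verts (edge_induced E) = \<Union>E" by (simp add: edge_induced_def)
  \<comment> \<open>The value 0 off the subgraph lets the degree gain be stated for all vertices of
    \<open>F\<close> at once.\<close>
  have deg_E: "vertex_degree (edge_induced E) x = (if x \<in> \<Union>E then r else 0)" for x
  proof (cases "x \<in> \<Union>E")
    case True
    then show ?thesis using reg unfolding regular_graph_def VE by auto
  next
    case False
    then have "{e \<in> edges (edge_induced E). x \<in> e} = {}" by (auto simp: edge_induced_def)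
    then show ?thesis using False by (simp only: vertex_degree_def) simp
  qed
  show "real p = 2 * real k / real r"
  proof (cases "E = {}")
    case True
    \<comment> \<open>Here \<open>p\<close> and \<open>k\<close> are both 0, and 0 divided by
      \<open>r\<close> is 0 even if \<open>r\<close> is 0.\<close>
    then show ?thesis using p E(2) unfolding VE by simp
  next
    case False
    then obtain e where e: "e \<in> E" by auto
    then obtain x where x: "x \<in> e" using ends by blast
    have "vertex_degree (edge_induced E) x \<noteq> 0"
      using e x P.finite_E by (auto simp: vertex_degree_def edge_induced_def)
    then have "r \<noteq> 0" using deg_E[of x] by (auto split: if_splits)
    moreover have "p * r = 2 * k"
      using sum_vertex_degree_edge_induced[OF P.finite_E P.card_E] p E(2)
      by (simp add: deg_E VE)
    then have "real p * real r = 2 * real k"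
      by (metis of_nat_mult of_nat_numeral)
    ultimately show ?thesis by (simp add: field_simps)
  qed

  have xs': "distinct xs" "set xs = verts F" and ys': "distinct ys" "set ys = verts H2"
    and zs': "distinct zs" "set zs = verts G"
    using xs ys zs by (simp_all add: vertex_ordering_def)
  have n: "length xs = n" using xs' F(2) distinct_card by fastforce
  have pn: "p \<le> n"
  proof -
    have "p = card (set (take p xs))" using p xs(2) by simp
    also have "\<dots> \<le> card (set xs)" by (intro card_mono) (auto dest: in_set_takeD)
    finally show ?thesis using n card_length[of xs] by linarith
  qed
  \<comment> \<open>The first \<open>p\<close> positions are exactly those of the subgraph; the
    converse uses distinctness, by which no vertex listed there recurs later.\<close>
  have corner: "i < p \<longleftrightarrow> xs ! i \<in> \<Union>E" if "i < n" for i
  proof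
    assume "i < p"
    then show "xs ! i \<in> \<Union>E"
      using that n xs(2) nth_mem[of i "take p xs"] by (simp add: VE)
  next
    assume "xs ! i \<in> \<Union>E"
    then have "xs ! i \<in> set (take p xs)" unfolding xs(2) VE .
    then obtain j where "j < p" "xs ! j = xs ! i"
      by (auto simp: in_set_conv_nth)
    then show "i < p"
      using xs'(1) that n pn by (simp add: nth_eq_iff_index_eq)
  qed
  have m: "card (verts H2) = m - 2"
  proof -
    have "card (verts H - {u, v}) = m - card {u, v}"
      using H uvH by (subst card_Diff_subset) (auto simp: simple_graph_def)
    then show ?thesis using P.u_neq_v by (simp add: H2 delete_verts_def)
  qed

  \<comment> \<open>\<open>d\<close> and \<open>f\<close> are the entries of (x - 2) I - Q(H_2) and
    x I - Q(G); \<open>g\<close> is negative because Q(G) is subtracted.\<close>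
  define d :: "'b \<Rightarrow> 'b \<Rightarrow> ratfun" where
    "d w w' = (if w = w' then rf_X - 2 else 0) - rf_const (signless_entry H2 w w')" for w w'
  define f :: "'a + 'a set \<times> 'b \<Rightarrow> 'a + 'a set \<times> 'b \<Rightarrow> ratfun" where
    "f a b = (if a = b then rf_X else 0) - rf_const (signless_entry G a b)" for a b
  define g :: "'a set \<Rightarrow> 'a \<Rightarrow> ratfun" where "g e a = - of_bool (a \<in> e)" for e a
  define c where "c = coronal (signless_laplacian ys H2) (rf_X - 2)"

  have det_d: "to_fract (char_poly (signless_laplacian ys H2) \<circ>\<^sub>p [:- 2, 1:]) =
      det (entry_mat ys ys d)"
    using to_fract_char_poly_pcompose[OF ys'(1), of "signless_entry H2" "[:- 2, 1:]"]
    unfolding signless_laplacian_eq_entry_mat[OF ys'(1)] rf_X_minus_2[symmetric] d_def by simp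
  \<comment> \<open>A characteristic polynomial is monic, and composition with the nonconstant x - 2
    keeps it nonzero, so the pocket block is invertible.\<close>
  have "det (entry_mat ys ys d) \<noteq> 0"
  proof -
    have "char_poly (entry_mat ys ys (signless_entry H2)) \<noteq> 0"
      using degree_monic_char_poly[OF entry_mat_carrier[of ys ys "signless_entry H2"]] by auto
    then show ?thesis
      unfolding det_d[symmetric] signless_laplacian_eq_entry_mat[OF ys'(1)]
      by (simp add: pcompose_eq_0_iff)
  qed
  then obtain D' where D': "mat_inverse (entry_mat ys ys d) = Some D'"
    "entry_mat ys ys d * D' = 1\<^sub>m (length ys)" "D' \<in> carrier_mat (length ys) (length ys)"
    by (rule mat_inverse_Some[OF entry_mat_carrier])
  have c: "c = vec (length ys) (\<lambda>_. 1) \<bullet> (D' *\<^sub>v vec (length ys) (\<lambda>_. 1))"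
  proof -
    \<comment> \<open>The matrix inverted in the coronal is the pocket block itself, so its inverse
      is \<open>D'\<close>.\<close>
    have "(rf_X - 2) \<cdot>\<^sub>m 1\<^sub>m (length ys) - map_mat rf_const (entry_mat ys ys (signless_entry H2)) =
        entry_mat ys ys d"
      using ys'(1) by (intro eq_matI) (auto simp: d_def nth_eq_iff_index_eq)
    then show ?thesis
      by (simp add: c_def coronal_def Let_def signless_laplacian_eq_entry_mat ys'(1) D'(1))
  qed

  obtain es where es: "set es = E" "distinct es"
    using P.finite_E finite_distinct_list by blast
  have "to_fract (char_poly (signless_laplacian zs G)) = det (entry_mat zs zs f)"
    unfolding f_def signless_laplacian_eq_entry_mat[OF zs'(1)]
    by (rule to_fract_char_poly[OF zs'(1)])
  \<comment> \<open>The determinant does not depend on the ordering, so \<open>zs\<close> may be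
    replaced by the vertices of \<open>F\<close> followed by the pockets.\<close>
  also have "\<dots> = det (entry_mat (pocket_order xs ys es) (pocket_order xs ys es) f)"
    using zs' xs' ys' es
    by (intro det_entry_mat_reorder distinct_pocket_order)
      (simp_all add: set_pocket_order P.verts_G G H2)
  also have "\<dots> = det (entry_mat ys ys d) ^ length es *
      det (entry_mat xs xs (\<lambda>a b. f (Inl a) (Inl b) - c * (\<Sum>e\<in>set es. g e a * g e b)))"
    using D'(3,2) c es(2)
  proof (rule det_pocket_order)
    fix e e' w w' assume *: "e \<in> set es" "e' \<in> set es" "w \<in> set ys" "w' \<in> set ys"
    have "rf_const 2 = 2" using rf_const_of_nat[of 2] by simp
    with * show "f (Inr (e, w)) (Inr (e', w')) = (if e = e' then d w w' else 0)"
      by (simp add: f_def d_def G P.signless_entry_G_Inr_Inr es ys' H2)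
  qed (simp_all add: f_def g_def G P.signless_entry_G_Inl_Inr es ys' H2)
  also have "length es = k" using es E(2) distinct_card by fastforce
  also have "entry_mat xs xs (\<lambda>a b. f (Inl a) (Inl b) - c * (\<Sum>e\<in>set es. g e a * g e b)) =
      rf_X \<cdot>\<^sub>m 1\<^sub>m n - M"
  proof -
    let ?QE = "entry_mat (take p xs) (take p xs) (signless_entry (edge_induced E))"
    have len: "length (take p xs) = p" using n pn by simp
    have QE: "signless_laplacian (take p xs) (edge_induced E) = ?QE"
      using xs'(1) by (simp add: signless_laplacian_eq_entry_mat)
    have QE': "map_mat rf_const ?QE \<in> carrier_mat p p" using len by auto
    have QE_entry: "signless_entry (edge_induced E) a b =
        (\<Sum>e\<in>E. of_bool (a \<in> e) * of_bool (b \<in> e))" for a b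
      by (rule signless_entry_edge_induced[OF P.finite_E P.card_E])
    \<comment> \<open>The two minus signs from \<open>g\<close> cancel, leaving the incidence form
      of Q of the induced subgraph.\<close>
    have sum: "(\<Sum>e\<in>set es. g e a * g e b) = rf_const (signless_entry (edge_induced E) a b)" for a b
      unfolding QE_entry rf_const_sum es g_def
      by (intro sum.cong) auto
    \<comment> \<open>\<open>corner_block\<close> is 0 outside the first \<open>p\<close> positions;
      the entry function vanishes there too, so both agree at all indices.\<close>
    have zero: "signless_entry (edge_induced E) a b = 0" if "a \<notin> \<Union>E \<or> b \<notin> \<Union>E" for a b
      unfolding QE_entry using that
      by (intro sum.neutral) auto
    show ?thesis
    proof (rule eq_matI)
      fix i j assume "i < dim_row (rf_X \<cdot>\<^sub>m 1\<^sub>m n - M)" "j < dim_col (rf_X \<cdot>\<^sub>m 1\<^sub>m n - M)"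
      then have ij: "i < n" "j < n"
        using corner_block_carrier[OF QE' pn] by (auto simp: M QE)
      have "M $$ (i, j) = rf_const (signless_entry F (xs ! i) (xs ! j)) +
          (if i = j \<and> i < p then of_nat (r * (m - 2)) else 0) +
          c * rf_const (signless_entry (edge_induced E) (xs ! i) (xs ! j))"
        using ij n corner_block_carrier[OF QE' pn] corner_block_carrier[OF one_carrier_mat pn]
          zero[of "xs ! i" "xs ! j"] corner
        by (auto simp: M QE c_def[symmetric] signless_laplacian_eq_entry_mat xs'(1)
            index_corner_block[OF QE' pn] index_corner_block[OF one_carrier_mat pn])
      \<comment> \<open>A vertex among the first \<open>p\<close> gains \<open>r\<close> copies of
        H_2 with m - 2 vertices each, whence the term \<open>r * (m - 2)\<close>.\<close>
      moreover have "f (Inl (xs ! i)) (Inl (xs ! j)) =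
          (if i = j then rf_X else 0) - rf_const (signless_entry F (xs ! i) (xs ! j)) -
          (if i = j \<and> i < p then of_nat (r * (m - 2)) else 0)"
        using ij n xs'(1) corner m rf_const_of_nat[of "r * (m - 2)"]
        by (simp add: f_def G P.signless_entry_G_Inl_Inl deg_E nth_eq_iff_index_eq H2
            del: rf_const_of_nat of_nat_mult)
      moreover have "M \<in> carrier_mat n n"
        using corner_block_carrier[OF QE' pn] n by (auto simp: M QE)
      ultimately show "entry_mat xs xs
            (\<lambda>a b. f (Inl a) (Inl b) - c * (\<Sum>e\<in>set es. g e a * g e b)) $$ (i, j) =
          (rf_X \<cdot>\<^sub>m 1\<^sub>m n - M) $$ (i, j)"
        using ij n by (simp add: sum)
    qed (use corner_block_carrier[OF QE' pn] n in \<open>auto simp: M QE\<close>)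
  qed
  finally show "to_fract (char_poly (signless_laplacian zs G)) =
      to_fract (char_poly (signless_laplacian ys H2) \<circ>\<^sub>p [:- 2, 1:]) ^ k
        * det (rf_X \<cdot>\<^sub>m 1\<^sub>m n - M)"
    by (simp only: det_d)
qed

end
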